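(* Let $\Bbbk$ be an algebraically closed field of characteristic zero, let $n,d\ge2$, and let $(c,q)$ be a reduced pair of degrees $(n,d)$ over $\Bbbk$. If $\Lambda(c,q)=\mathbb Z^2$, then $G_{c,q}=\{1\}$ (the trivial group).
   Context: A reduced pair $(c,q)$ of degrees $(n,d)$ consists of $c(x)=\sum_{r=0}^{n}c_rx^r\in\Bbbk[x]$ with $c_n\neq0$, $c_{n-1}=0$, and $q(x,y)=\lambda y^d+\sum_{0\le i<n,\ 0\le j\le d-2}q_{ij}x^iy^j\in\Bbbk[x,y]$ with $\lambda\in\Bbbk^*$. The diagonal group is $G_{c,q}=\{(e,u)\in\Bbbk^*\times\Bbbk^*\mid c(ex)=e^nc(x),\ q(ex,uy)=u^dq(x,y)\}$, a subgroup of $\Bbbk^*\times\Bbbk^*$. $\Lambda(c,q)$ is the subgroup of $\mathbb Z^2$ generated by the vectors $(n-r,0)$ for all $r<n$ with $c_r\neq0$, together with the vectors $(i,j-d)$ for all pairs $(i,j)$ with $q_{ij}\neq0$. *)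

theory Defs
  imports
    "HOL-Computational_Algebra.Polynomial"
    "HOL-Computational_Algebra.Group_Closure"
    "HOL-Library.Product_Plus"
begin

text \<open>
  A bivariate polynomial in \<open>x, y\<close> is an element of \<open>\<Bbbk>[x][y]\<close>, i.e. of type \<open>'a poly poly\<close>:
  the outer variable is \<open>y\<close> and the coefficients are polynomials in \<open>x\<close>.
\<close>

definition coeff2 :: "'a::zero poly poly \<Rightarrow> nat \<Rightarrow> nat \<Rightarrow> 'a" where
  "coeff2 q i j = coeff (coeff q j) i"  \<comment> \<open>coefficient of \<open>x\<^sup>i y\<^sup>j\<close>\<close>

definition monom2 :: "'a::zero \<Rightarrow> nat \<Rightarrow> nat \<Rightarrow> 'a poly poly" where
  "monom2 a i j = monom (monom a i) j"  \<comment> \<open>\<open>a x\<^sup>i y\<^sup>j\<close>\<close>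

definition scale1 :: "'a::comm_ring_1 \<Rightarrow> 'a poly \<Rightarrow> 'a poly" where
  "scale1 e c = pcompose c [:0, e:]"  \<comment> \<open>\<open>c(e x)\<close>\<close>

definition scale2 :: "'a::comm_ring_1 \<Rightarrow> 'a \<Rightarrow> 'a poly poly \<Rightarrow> 'a poly poly" where
  "scale2 e u q = pcompose (map_poly (scale1 e) q) [:0, [:u:]:]"  \<comment> \<open>\<open>q(e x, u y)\<close>\<close>

definition reduced_pair :: "nat \<Rightarrow> nat \<Rightarrow> 'a::field poly \<Rightarrow> 'a poly poly \<Rightarrow> bool" where
  "reduced_pair n d c q \<longleftrightarrow>
     degree c \<le> n \<and> coeff c n \<noteq> 0 \<and> coeff c (n - 1) = 0 \<and>
     (\<exists>l a. l \<noteq> 0 \<and> q = monom2 l 0 d + (\<Sum>i<n. \<Sum>j\<le>d-2. monom2 (a i j) i j))"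

definition diagonal_group ::
    "nat \<Rightarrow> nat \<Rightarrow> 'a::field poly \<Rightarrow> 'a poly poly \<Rightarrow> ('a \<times> 'a) set" where
  "diagonal_group n d c q =
     {(e, u). e \<noteq> 0 \<and> u \<noteq> 0 \<and>
        scale1 e c = smult (e ^ n) c \<and> scale2 e u q = smult [:u ^ d:] q}"

text \<open>
  The indices \<open>(i, j)\<close> range over the non-leading terms of \<open>q\<close> only, so that \<open>(0, d)\<close> is excluded
  (it would contribute the zero vector).
\<close>

definition exponent_lattice ::
    "nat \<Rightarrow> nat \<Rightarrow> 'a::field poly \<Rightarrow> 'a poly poly \<Rightarrow> (int \<times> int) set" where
  "exponent_lattice n d c q = group_closure
     ({(int n - int r, 0) | r. r < n \<and> coeff c r \<noteq> 0} \<union>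
      {(int i, int j - int d) | i j. i < n \<and> j \<le> d - 2 \<and> coeff2 q i j \<noteq> 0})"

lemma coeff_scale1: "coeff (scale1 e c) r = e ^ r * coeff c r"
  by (simp add: scale1_def coeff_pcompose_linear)

lemma coeff2_scale2: "coeff2 (scale2 e u q) i j = e ^ i * u ^ j * coeff2 q i j"
proof -
  have "scale1 e 0 = 0"
    by (simp add: scale1_def)
  moreover have "[:u:] ^ j = [:u ^ j:]"
    by (simp add: poly_const_pow)
  ultimately show ?thesis
    by (simp add: coeff2_def scale2_def coeff_pcompose_linear coeff_map_poly coeff_scale1)
qed

lemma poly_poly_scale2:
  "poly (poly (scale2 e u q) [:y:]) x = poly (poly q [:u * y:]) (e * x)"
  for q :: "'a::comm_ring_1 poly poly"
proof -
  have 0: "scale1 e 0 = 0"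
    by (simp add: scale1_def)
  have 1: "poly (poly (map_poly (scale1 e) q) [:z:]) x = poly (poly q [:z:]) (e * x)" for z
    by (induction q)
       (simp_all add: map_poly_pCons 0 scale1_def poly_pcompose algebra_simps)
  show ?thesis
    using 1[of "u * y"] by (simp add: scale2_def poly_pcompose algebra_simps)
qed

end

theory Submission
  imports Defs
begin

text \<open>
  For fixed nonzero \<open>e, u\<close> the exponent vectors \<open>(a, b)\<close> with \<open>e\<^sup>a u\<^sup>b = 1\<close> form a subgroup of
  \<open>\<int>\<^sup>2\<close>. Comparing coefficients in \<open>c(e x) = e\<^sup>n c(x)\<close> and \<open>q(e x, u y) = u\<^sup>d q(x, y)\<close>
  shows that, for \<open>(e, u)\<close> in the diagonal group, this subgroup contains every generator of the
  exponent lattice, hence the whole lattice (\<open>exponent_lattice_character_eq_1\<close>): the diagonal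
  group lies in the annihilator of the lattice under the pairing
  \<open>\<int>\<^sup>2 \<times> (\<Bbbk>\<^sup>* \<times> \<Bbbk>\<^sup>*) \<rightarrow> \<Bbbk>\<^sup>*\<close>. If the lattice is all of \<open>\<int>\<^sup>2\<close>, evaluating at
  \<open>(1, 0)\<close> and \<open>(0, 1)\<close> gives \<open>e = u = 1\<close>.
\<close>

text \<open>
  Each \<open>(e, u)\<close> defines a character of \<open>\<int>\<^sup>2\<close>, whose kernel is a subgroup; so triviality
  on generators suffices.
\<close>

lemma character_eq_1_on_group_closure:
  fixes e u :: "'a::field"
  assumes "e \<noteq> 0" and "u \<noteq> 0"
    and gen: "\<And>a b. (a, b) \<in> S \<Longrightarrow> e powi a * u powi b = 1"
    and "v \<in> group_closure S"
  shows "e powi fst v * u powi snd v = 1"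
  using assms(4)
proof induction
  case (base s)
  \<comment> \<open>Generators of a group closure are taken from \<open>insert 0 S\<close>.\<close>
  then show ?case
    using gen[of "fst s" "snd s"] by auto
next
  case (diff s t)
  have "e powi fst (s - t) * u powi snd (s - t)
      = (e powi fst s * u powi snd s) / (e powi fst t * u powi snd t)"
    using assms(1,2) by (simp add: power_int_diff)
  then show ?case
    using diff.IH by simp
qed

lemma exponent_lattice_character_eq_1:
  fixes c :: "'a::field poly"
  assumes "(e, u) \<in> diagonal_group n d c q" and "v \<in> exponent_lattice n d c q"
  shows "e powi fst v * u powi snd v = 1"
proof -
  have nz: "e \<noteq> 0" "u \<noteq> 0"
    and c: "scale1 e c = smult (e ^ n) c" and q: "scale2 e u q = smult [:u ^ d:] q"
    using assms(1) by (auto simp: diagonal_group_def)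
  have gen_c: "e powi (int n - int r) = 1" if "coeff c r \<noteq> 0" for r
  proof -
    have "e ^ r * coeff c r = e ^ n * coeff c r"
      using arg_cong[OF c, of "\<lambda>p. coeff p r"] by (simp add: coeff_scale1)
    then show ?thesis
      using that nz by (simp add: power_int_diff)
  qed
  have gen_q: "e ^ i * u powi (int j - int d) = 1" if "coeff2 q i j \<noteq> 0" for i j
  proof -
    have "e ^ i * u ^ j * coeff2 q i j = u ^ d * coeff2 q i j"
      using arg_cong[OF q, of "\<lambda>p. coeff2 p i j"]
      unfolding coeff2_scale2 by (simp add: coeff2_def)
    then show ?thesis
      using that nz by (simp add: power_int_diff)
  qed
  show ?thesis
    using assms(2) unfolding exponent_lattice_def
    by (rule character_eq_1_on_group_closure[OF nz, rotated]) (auto simp: gen_c gen_q)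
qed

lemma one_in_diagonal_group: "(1, 1) \<in> diagonal_group n d c q"
proof -
  have "scale1 1 c = c" for c :: "'a poly"
    by (rule poly_eqI) (simp add: coeff_scale1)
  moreover have "scale2 1 1 q = q"
    by (intro poly_eqI) (use coeff2_scale2[of 1 1 q] in \<open>simp add: coeff2_def\<close>)
  ultimately show ?thesis
    by (simp add: diagonal_group_def flip: one_pCons)
qed

theorem proposition11:
  fixes c :: "'a::{alg_closed_field, field_char_0} poly"
    and q :: "'a poly poly"
    and n d :: nat
  assumes "n \<ge> 2" and "d \<ge> 2"
    and "reduced_pair n d c q"
    and "exponent_lattice n d c q = UNIV"
  shows "diagonal_group n d c q = {(1, 1)}"
proof -
  have "e = 1 \<and> u = 1" if "(e, u) \<in> diagonal_group n d c q" for e u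
    using exponent_lattice_character_eq_1[OF that, of "(1, 0)"]
      exponent_lattice_character_eq_1[OF that, of "(0, 1)"] assms(4)
    by simp
  then show ?thesis
    using one_in_diagonal_group[of n d c q] by auto
qed

end
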